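(* Let $g=dr^2+f(r,\theta)^2\,d\theta^2$ be a Riemannian metric on $\mathbb{R}^2$ (written in polar coordinates $(r,\theta)$ about the origin) whose Gaussian curvature $K_g(r,\theta)=-\frac{f''(r,\theta)}{f(r,\theta)}$ is nonnegative everywhere. Let $u:\mathbb{R}^2\to\mathbb{R}$ be a harmonic function with respect to $g$, i.e. $\Delta_g u=0$. Suppose that for every $\delta>0$, \[ \liminf_{r\to\infty}\frac{M(u;r)}{r^{1+\delta}}=0 . \] Then $u$ has at most linear growth: there is a constant $C>0$ such that $|u(r,\theta)|\le C(1+r)$ for all $(r,\theta)$.
   Context: Here $f:(0,\infty)\times[0,2\pi]\to(0,\infty)$ is smooth with $f(r,0)=f(r,2\pi)$, $\lim_{r\to0^+}f(r,\theta)=0$ and $\lim_{r\to0^+}f'(r,\theta)=1$, where $'$ denotes $\partial/\partial r$; thus $g$ is a smooth metric on $\mathbb{R}^2$ for which polar coordinates about the origin are geodesic polar coordinates, and $r$ is the $g$-distance to the origin. The Laplacian of $g$ is \[ \Delta_g=\frac{\partial^2}{\partial r^2}+\frac{f'}{f}\frac{\partial}{\partial r}+\frac{1}{f^2}\frac{\partial^2}{\partial\theta^2}-\frac{f_\theta}{f^3}\frac{\partial}{\partial\theta},\qquad f_\theta=\frac{\partial f}{\partial\theta}. \] For a continuous function $v$, $M(v;r)=\sup_{\theta\in[0,2\pi)}|v(r,\theta)|$. *)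

theory Defs
  imports "HOL-Analysis.Analysis"
begin

definition dr :: "(real \<Rightarrow> real \<Rightarrow> real) \<Rightarrow> real \<Rightarrow> real \<Rightarrow> real" where
  "dr F r t = deriv (\<lambda>s. F s t) r"

definition dt :: "(real \<Rightarrow> real \<Rightarrow> real) \<Rightarrow> real \<Rightarrow> real \<Rightarrow> real" where
  "dt F r t = deriv (\<lambda>s. F r s) t"

fun iterD :: "bool list \<Rightarrow> (real \<Rightarrow> real \<Rightarrow> real) \<Rightarrow> real \<Rightarrow> real \<Rightarrow> real" where
  "iterD [] F = F"
| "iterD (b # bs) F = (if b then dr else dt) (iterD bs F)"

definition smooth_polar :: "(real \<Rightarrow> real \<Rightarrow> real) \<Rightarrow> bool" where
  "smooth_polar F \<longleftrightarrow>
     (\<forall>ds. continuous_on ({0<..} \<times> UNIV) (\<lambda>(r, t). iterD ds F r t)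
        \<and> (\<forall>r>0. \<forall>t. (\<lambda>s. iterD ds F s t) differentiable (at r)
                   \<and> (\<lambda>s. iterD ds F r s) differentiable (at t)))"

definition polar :: "(real \<times> real \<Rightarrow> real) \<Rightarrow> real \<Rightarrow> real \<Rightarrow> real" where
  "polar u r t = u (r * cos t, r * sin t)"

text \<open>Laplacian of g = dr^2 + f^2 dtheta^2 in geodesic polar coordinates.\<close>
definition lap_g :: "(real \<Rightarrow> real \<Rightarrow> real) \<Rightarrow> (real \<Rightarrow> real \<Rightarrow> real) \<Rightarrow> real \<Rightarrow> real \<Rightarrow> real" where
  "lap_g f v r t =
     dr (dr v) r t + dr f r t / f r t * dr v r t + dt (dt v) r t / (f r t)^2
     - dt f r t / (f r t)^3 * dt v r t"

definition curv :: "(real \<Rightarrow> real \<Rightarrow> real) \<Rightarrow> real \<Rightarrow> real \<Rightarrow> real" where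
  "curv f r t = - dr (dr f) r t / f r t"

definition Mmax :: "(real \<Rightarrow> real \<Rightarrow> real) \<Rightarrow> real \<Rightarrow> real" where
  "Mmax v r = (SUP t\<in>{0..<2*pi}. \<bar>v r t\<bar>)"

end

theory Submission
  imports Defs
begin

text \<open>Concavity of \<open>f\<close> in \<open>r\<close> gives \<open>0 \<le> f'/f \<le> 1/r\<close>, so \<open>ln r\<close> is superharmonic, while the
  Bochner formula with \<open>K \<ge> 0\<close> makes \<open>ln (1 + |\<nabla>u|\<^sup>2)\<close> subharmonic. Comparing the two on annuli
  \<open>1 \<le> r \<le> R\<close> yields a three circles inequality for \<open>|\<nabla>u|\<close>. Bernstein's gradient estimate turns
  the growth hypothesis on \<open>u\<close> into \<open>|\<nabla>u|\<^sup>2 \<le> C R\<^sup>\<delta>\<close> on arbitrarily large circles, for every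
  \<open>\<delta> > 0\<close>; hence \<open>|\<nabla>u|\<close> is bounded on \<open>r \<ge> 1\<close>, and \<open>u\<close> grows at most linearly. All
  comparisons take place on annuli, because the polar data may be singular at the origin.\<close>

section \<open>Partial derivatives in polar coordinates\<close>

text \<open>The mean value theorem acts first on \<open>F s (b+h) - F s b\<close>, then on
  \<open>F1\<close>. The second difference so evaluated does not depend on the order of the
  variables.\<close>

lemma double_mean_value:
  fixes F :: "real \<Rightarrow> real \<Rightarrow> real"
  assumes "h > 0"
    and F1: "\<And>x y. x \<in> {a..a+h} \<Longrightarrow> y \<in> {b..b+h} \<Longrightarrow>
      ((\<lambda>s. F s y) has_real_derivative F1 x y) (at x)"
    and F12: "\<And>x y. x \<in> {a..a+h} \<Longrightarrow> y \<in> {b..b+h} \<Longrightarrow>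
      ((\<lambda>s. F1 x s) has_real_derivative F12 x y) (at y)"
  obtains x y where "x \<in> {a<..<a+h}" "y \<in> {b<..<b+h}"
    "F (a+h) (b+h) - F (a+h) b - F a (b+h) + F a b = h\<^sup>2 * F12 x y"
proof -
  have "\<exists>z>a. z < a + h \<and> (F (a+h) (b+h) - F (a+h) b) - (F a (b+h) - F a b)
      = (a + h - a) * (F1 z (b+h) - F1 z b)"
    using \<open>h > 0\<close> by (intro MVT2) (auto intro!: DERIV_diff F1)
  then obtain x where x: "a < x" "x < a + h"
    "(F (a+h) (b+h) - F (a+h) b) - (F a (b+h) - F a b) = h * (F1 x (b+h) - F1 x b)"
    by auto
  have "\<exists>z>b. z < b + h \<and> F1 x (b+h) - F1 x b = (b + h - b) * F12 x z"
    using \<open>h > 0\<close> x by (intro MVT2) (auto intro!: F12)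
  then obtain y where "b < y" "y < b + h" "F1 x (b+h) - F1 x b = h * F12 x y"
    by auto
  with x show ?thesis
    by (intro that[of x y]) (auto simp: power2_eq_square)
qed

lemma iterD_append: "iterD (xs @ ys) F = iterD xs (iterD ys F)"
  by (induction xs) auto

lemma smooth_polar_iterD:
  assumes "smooth_polar F"
  shows "smooth_polar (iterD ds F)"
  using assms unfolding smooth_polar_def iterD_append[symmetric] by blast

lemma smooth_polar_dr: "smooth_polar F \<Longrightarrow> smooth_polar (dr F)"
  and smooth_polar_dt: "smooth_polar F \<Longrightarrow> smooth_polar (dt F)"
  using smooth_polar_iterD[of F "[True]"] smooth_polar_iterD[of F "[False]"] by auto

lemma smooth_polar_continuous:
  "smooth_polar F \<Longrightarrow> continuous_on ({0<..} \<times> UNIV) (\<lambda>(r, t). F r t)"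
  unfolding smooth_polar_def by (metis iterD.simps(1))

lemma smooth_polar_has_dr:
  assumes "smooth_polar F" "r > 0"
  shows "((\<lambda>s. F s t) has_real_derivative dr F r t) (at r)"
proof -
  have "(\<lambda>s. iterD [] F s t) differentiable (at r)"
    using assms unfolding smooth_polar_def by blast
  then show ?thesis
    by (simp add: dr_def DERIV_deriv_iff_real_differentiable)
qed

lemma smooth_polar_has_dt:
  assumes "smooth_polar F" "r > 0"
  shows "((\<lambda>s. F r s) has_real_derivative dt F r t) (at t)"
proof -
  have "(\<lambda>s. iterD [] F r s) differentiable (at t)"
    using assms unfolding smooth_polar_def by blast
  then show ?thesis
    by (simp add: dt_def DERIV_deriv_iff_real_differentiable)
qed

text \<open>Schwarz's theorem: the second difference over a square with corner \<open>(a, b)\<close>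
  is \<open>h\<^sup>2\<close> times a value of either mixed derivative, and by continuity both
  values are close to those at the corner.\<close>

lemma dr_dt_commute:
  assumes F: "smooth_polar F" and "a > 0"
  shows "dr (dt F) a b = dt (dr F) a b"
proof (rule ccontr)
  define e where "e = \<bar>dr (dt F) a b - dt (dr F) a b\<bar> / 2"
  assume "\<not> ?thesis"
  then have e: "e > 0" by (simp add: e_def)
  have near: "\<exists>d>0. \<forall>x y. x \<in> {a<..<a+d} \<longrightarrow> y \<in> {b<..<b+d} \<longrightarrow> \<bar>G x y - G a b\<bar> < e"
    if "smooth_polar G" for G
  proof -
    have "continuous_on ({0<..} \<times> UNIV) (\<lambda>(r, t). G r t)"
      using that by (rule smooth_polar_continuous)
    then obtain d where d: "d > 0"
      "\<And>p. p \<in> {0<..} \<times> UNIV \<Longrightarrow> dist p (a, b) < d \<Longrightarrow>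
        dist ((\<lambda>(r, t). G r t) p) ((\<lambda>(r, t). G r t) (a, b)) < e"
      using bspec[OF iffD1[OF continuous_on_iff], of _ _ "(a, b)"] \<open>a > 0\<close> e
      by fastforce
    have "\<bar>G x y - G a b\<bar> < e" if "x \<in> {a<..<a+d/2}" "y \<in> {b<..<b+d/2}" for x y
    proof -
      have "dist (x, y) (a, b) \<le> \<bar>x - a\<bar> + \<bar>y - b\<bar>"
        using sqrt_sum_squares_le_sum_abs[of "x - a" "y - b"]
        by (simp add: dist_Pair_Pair dist_real_def)
      also have "\<dots> < d" using that by auto
      finally show ?thesis
        using d(2)[of "(x, y)"] that \<open>a > 0\<close> by (simp add: dist_real_def)
    qed
    then show ?thesis using d(1) by (intro exI[of _ "d/2"]) auto
  qed
  obtain d1 where d1: "d1 > 0" "\<And>x y. x \<in> {a<..<a+d1} \<Longrightarrow> y \<in> {b<..<b+d1} \<Longrightarrow>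
      \<bar>dr (dt F) x y - dr (dt F) a b\<bar> < e"
    using near[OF smooth_polar_dr[OF smooth_polar_dt[OF F]]] by blast
  obtain d2 where d2: "d2 > 0" "\<And>x y. x \<in> {a<..<a+d2} \<Longrightarrow> y \<in> {b<..<b+d2} \<Longrightarrow>
      \<bar>dt (dr F) x y - dt (dr F) a b\<bar> < e"
    using near[OF smooth_polar_dt[OF smooth_polar_dr[OF F]]] by blast
  define h where "h = min d1 d2"
  have h: "h > 0" "h \<le> d1" "h \<le> d2" using d1 d2 by (auto simp: h_def)
  obtain x y where xy: "x \<in> {a<..<a+h}" "y \<in> {b<..<b+h}"
    "F (a+h) (b+h) - F (a+h) b - F a (b+h) + F a b = h\<^sup>2 * dt (dr F) x y"
    by (rule double_mean_value[of h a b F "dr F" "dt (dr F)"])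
       (use h \<open>a > 0\<close> in \<open>auto intro!: smooth_polar_has_dr smooth_polar_has_dt smooth_polar_dr F\<close>)
  obtain y' x' where xy': "y' \<in> {b<..<b+h}" "x' \<in> {a<..<a+h}"
    "F (a+h) (b+h) - F a (b+h) - F (a+h) b + F a b = h\<^sup>2 * dr (dt F) x' y'"
    by (rule double_mean_value[of h b a "\<lambda>t r. F r t" "\<lambda>t r. dt F r t" "\<lambda>t r. dr (dt F) r t"])
       (use h \<open>a > 0\<close> in \<open>auto intro!: smooth_polar_has_dr smooth_polar_has_dt smooth_polar_dt F\<close>)
  have "dt (dr F) x y = dr (dt F) x' y'"
  proof -
    have "h\<^sup>2 * dt (dr F) x y = h\<^sup>2 * dr (dt F) x' y'"
      using xy(3) xy'(3) by linarith
    then show ?thesis using h(1) by simp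
  qed
  moreover have "\<bar>dt (dr F) x y - dt (dr F) a b\<bar> < e" "\<bar>dr (dt F) x' y' - dr (dt F) a b\<bar> < e"
    using xy xy' h by (auto intro!: d1 d2)
  ultimately show False unfolding e_def by (simp add: abs_if split: if_splits)
qed

lemma dr_periodic:
  assumes "smooth_polar F" and per: "\<And>r t. r > 0 \<Longrightarrow> F r (t + 2 * pi) = F r t" and "r > 0"
  shows "dr F r (t + 2 * pi) = dr F r t"
proof (rule DERIV_unique)
  show "((\<lambda>s. F s t) has_real_derivative dr F r t) (at r)"
    by (intro smooth_polar_has_dr assms)
  show "((\<lambda>s. F s t) has_real_derivative dr F r (t + 2 * pi)) (at r)"
    by (rule has_field_derivative_transform_within_open[OF smooth_polar_has_dr, where S = "{0<..}"])
       (use assms in auto)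
qed

lemma dt_periodic:
  assumes "smooth_polar F" and per: "\<And>r t. r > 0 \<Longrightarrow> F r (t + 2 * pi) = F r t" and "r > 0"
  shows "dt F r (t + 2 * pi) = dt F r t"
proof (rule DERIV_unique)
  show "((\<lambda>s. F r s) has_real_derivative dt F r t) (at t)"
    by (intro smooth_polar_has_dt assms)
  have "((\<lambda>s. F r (s + 2 * pi)) has_real_derivative dt F r (t + 2 * pi)) (at t)"
    using smooth_polar_has_dt[OF assms(1,3), of "t + 2 * pi"] DERIV_shift by blast
  then show "((\<lambda>s. F r s) has_real_derivative dt F r (t + 2 * pi)) (at t)"
    using per \<open>r > 0\<close> by simp
qed

section \<open>The maximum principle on annuli\<close>

text \<open>As \<open>g' x = 0\<close>, a positive \<open>g''\<close> would make \<open>g'\<close>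
  positive just to the right of \<open>x\<close>, so \<open>g\<close> would increase there.\<close>

lemma second_derivative_nonpos_at_max:
  fixes g g' :: "real \<Rightarrow> real"
  assumes "d > 0"
    and g: "\<And>y. \<bar>y - x\<bar> < d \<Longrightarrow> (g has_real_derivative g' y) (at y)"
    and g': "(g' has_real_derivative g'') (at x)"
    and max: "\<And>y. \<bar>y - x\<bar> < d \<Longrightarrow> g y \<le> g x"
  shows "g' x = 0" "g'' \<le> 0"
proof -
  show zero: "g' x = 0"
    using DERIV_local_max[OF g \<open>d > 0\<close>] max \<open>d > 0\<close> by (simp add: abs_minus_commute)
  show "g'' \<le> 0"
  proof (rule ccontr)
    assume "\<not> ?thesis"
    then obtain e where e: "e > 0" "\<And>h. 0 < h \<Longrightarrow> h < e \<Longrightarrow> g' x < g' (x + h)"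
      using DERIV_pos_inc_right[OF g'] by auto
    define h where "h = min d e / 2"
    have h: "0 < h" "h < d" "h < e" using \<open>d > 0\<close> e(1) by (auto simp: h_def)
    obtain z where z: "x < z" "z < x + h" "g (x + h) - g x = (x + h - x) * g' z"
      using MVT2[of x "x + h" g g'] h g by auto
    have "g' z > 0" using e(2)[of "z - x"] z h zero by auto
    then have "g (x + h) > g x" using z h by (simp add: algebra_simps)
    moreover have "g (x + h) \<le> g x" using h by (intro max) auto
    ultimately show False by simp
  qed
qed

text \<open>Subtracting whole periods lets compactness of \<open>{0..2*pi}\<close> control all
  angles.\<close>

lemma periodic_reduce:
  fixes F :: "real \<Rightarrow> 'a"
  assumes "\<And>t. F (t + 2 * pi) = F t"
  obtains s where "0 \<le> s" "s < 2 * pi" "F s = F t"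
proof -
  have nat: "F (x + 2 * pi * real n) = F x" for x n
  proof (induction n)
    case (Suc n)
    then show ?case using assms[of "x + 2 * pi * real n"] by (simp add: algebra_simps)
  qed simp
  have int: "F (x + 2 * pi * of_int k) = F x" for x k
  proof (cases "k \<ge> 0")
    case True
    then show ?thesis using nat[of x "nat k"] by simp
  next
    case False
    then show ?thesis using nat[of "x + 2 * pi * of_int k" "nat (- k)"] by simp
  qed
  define k where "k = \<lfloor>t / (2 * pi)\<rfloor>"
  have "of_int k \<le> t / (2 * pi)" "t / (2 * pi) < of_int k + 1"
    by (auto simp: k_def)
  then have "of_int k * (2 * pi) \<le> t" "t < (of_int k + 1) * (2 * pi)"
    by (auto simp: pos_le_divide_eq pos_divide_less_eq)
  then show ?thesis
    using int[of "t" "- k"] by (intro that[of "t + 2 * pi * of_int (- k)"]) (auto simp: algebra_simps)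
qed

text \<open>Weak maximum principle for a possibly degenerate elliptic operator without zeroth order
  term. By periodicity the angle has no boundary, so only the two circles count.\<close>

lemma annulus_maximum_principle:
  fixes \<psi> :: "real \<Rightarrow> real \<Rightarrow> real"
  assumes ab: "0 < a" "a \<le> b"
    and cont: "continuous_on ({a..b} \<times> UNIV) (\<lambda>(r, t). \<psi> r t)"
    and per: "\<And>r t. a \<le> r \<Longrightarrow> r \<le> b \<Longrightarrow> \<psi> r (t + 2 * pi) = \<psi> r t"
    and d1: "\<And>r t. a < r \<Longrightarrow> r < b \<Longrightarrow> ((\<lambda>s. \<psi> s t) has_real_derivative \<psi>r r t) (at r)"
    and d2: "\<And>r t. a < r \<Longrightarrow> r < b \<Longrightarrow> ((\<lambda>s. \<psi>r s t) has_real_derivative \<psi>rr r t) (at r)"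
    and d3: "\<And>r t. a < r \<Longrightarrow> r < b \<Longrightarrow> ((\<lambda>s. \<psi> r s) has_real_derivative \<psi>t r t) (at t)"
    and d4: "\<And>r t. a < r \<Longrightarrow> r < b \<Longrightarrow> ((\<lambda>s. \<psi>t r s) has_real_derivative \<psi>tt r t) (at t)"
    and coeff: "\<And>r t. a < r \<Longrightarrow> r < b \<Longrightarrow> k r t \<ge> 0" "\<And>r t. a < r \<Longrightarrow> r < b \<Longrightarrow> \<alpha> r t \<ge> 0"
    and sub: "\<And>r t. a < r \<Longrightarrow> r < b \<Longrightarrow>
      \<psi>rr r t + k r t * \<psi>r r t + \<alpha> r t * \<psi>tt r t + \<beta> r t * \<psi>t r t \<ge> 0"
    and bd: "\<And>t. \<psi> a t \<le> m" "\<And>t. \<psi> b t \<le> m"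
    and r: "a \<le> r" "r \<le> b"
  shows "\<psi> r t \<le> m"
proof -
  have eps: "\<psi> r t \<le> m + \<epsilon> * (b\<^sup>2 - r\<^sup>2)" if "\<epsilon> > 0" for \<epsilon>
  proof -
    \<comment> \<open>The perturbation makes the differential inequality strict, because
      the operator maps \<open>r\<^sup>2\<close> to \<open>2 + 2 r k \<ge> 2\<close>.\<close>
    define \<Psi> where "\<Psi> r t = \<psi> r t + \<epsilon> * (r\<^sup>2 - b\<^sup>2)" for r t
    have "continuous_on ({a..b} \<times> {0..2*pi}) (\<lambda>(r, t). \<Psi> r t)"
      unfolding \<Psi>_def case_prod_unfold
      by (intro continuous_intros continuous_on_subset[OF cont[unfolded case_prod_unfold]]) auto
    then obtain p where p: "p \<in> {a..b} \<times> {0..2*pi}"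
      "\<And>x. x \<in> {a..b} \<times> {0..2*pi} \<Longrightarrow> (\<lambda>(r, t). \<Psi> r t) x \<le> (\<lambda>(r, t). \<Psi> r t) p"
      using continuous_attains_sup[of "{a..b} \<times> {0..2*pi}" "\<lambda>(r, t). \<Psi> r t"] ab
      by (auto simp: compact_Times)
    obtain r0 t0 where p0: "p = (r0, t0)" by force
    have r0: "a \<le> r0" "r0 \<le> b" using p p0 by auto
    \<comment> \<open>Periodicity extends the maximum to all angles, so \<open>t0\<close> counts as
      interior even if it is \<open>0\<close> or \<open>2 * pi\<close>.\<close>
    have max: "\<Psi> s t' \<le> \<Psi> r0 t0" if s: "a \<le> s" "s \<le> b" for s t'
    proof -
      obtain t'' where "0 \<le> t''" "t'' < 2*pi" "\<Psi> s t'' = \<Psi> s t'"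
        by (rule periodic_reduce[of "\<Psi> s" t']) (use per s in \<open>auto simp: \<Psi>_def\<close>)
      then show ?thesis using p(2)[of "(s, t'')"] s p0 by auto
    qed
    have "\<Psi> r0 t0 \<le> m"
    proof (cases "a < r0 \<and> r0 < b")
      case False
      then have "r0 = a \<or> r0 = b" using r0 by auto
      moreover have "\<epsilon> * (a\<^sup>2 - b\<^sup>2) \<le> 0"
        using \<open>\<epsilon> > 0\<close> ab by (intro mult_nonneg_nonpos) (auto intro: power_mono)
      ultimately show ?thesis using bd[of t0] by (auto simp: \<Psi>_def)
    next
      case True
      define d where "d = min (r0 - a) (b - r0)"
      have d: "d > 0" using True by (auto simp: d_def)
      have R: "\<psi>r r0 t0 + 2 * \<epsilon> * r0 = 0" "\<psi>rr r0 t0 + 2 * \<epsilon> \<le> 0"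
      proof -
        have A: "((\<lambda>s. \<Psi> s t0) has_real_derivative \<psi>r s t0 + 2 * \<epsilon> * s) (at s)"
          if "\<bar>s - r0\<bar> < d" for s
          unfolding \<Psi>_def using that
          by (auto intro!: derivative_eq_intros d1 simp: d_def abs_if split: if_splits)
        have B: "((\<lambda>s. \<psi>r s t0 + 2 * \<epsilon> * s) has_real_derivative \<psi>rr r0 t0 + 2 * \<epsilon>) (at r0)"
          using True by (auto intro!: derivative_eq_intros d2)
        have C: "\<Psi> s t0 \<le> \<Psi> r0 t0" if "\<bar>s - r0\<bar> < d" for s
          using that by (intro max) (auto simp: d_def abs_if split: if_splits)
        show "\<psi>r r0 t0 + 2 * \<epsilon> * r0 = 0" "\<psi>rr r0 t0 + 2 * \<epsilon> \<le> 0"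
          using second_derivative_nonpos_at_max[OF d A B C] by auto
      qed
      have T: "\<psi>t r0 t0 = 0" "\<psi>tt r0 t0 \<le> 0"
      proof -
        have A: "((\<lambda>s. \<Psi> r0 s) has_real_derivative \<psi>t r0 s) (at s)" for s
          unfolding \<Psi>_def using True by (auto intro!: derivative_eq_intros d3)
        show "\<psi>t r0 t0 = 0" "\<psi>tt r0 t0 \<le> 0"
          using second_derivative_nonpos_at_max[OF zero_less_one A d4 max] True by auto
      qed
      \<comment> \<open>An interior maximum is impossible: there the operator applied to
        \<open>\<psi>\<close> is at most \<open>-2 * \<epsilon>\<close>, against
        \<open>sub\<close>.\<close>
      have "\<epsilon> * r0 \<ge> 0" using True ab \<open>\<epsilon> > 0\<close> by simp
      then have "k r0 t0 * \<psi>r r0 t0 \<le> 0"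
        using R(1) coeff(1)[of r0 t0] True by (intro mult_nonneg_nonpos) auto
      moreover have "\<alpha> r0 t0 * \<psi>tt r0 t0 \<le> 0"
        using T coeff(2)[of r0 t0] True by (intro mult_nonneg_nonpos) auto
      ultimately show ?thesis
        using sub[of r0 t0] True R(2) T(1) \<open>\<epsilon> > 0\<close> by simp
    qed
    with max[OF r, of t] show ?thesis by (simp add: \<Psi>_def algebra_simps)
  qed
  show ?thesis
  proof (rule field_le_epsilon)
    fix e :: real assume "e > 0"
    have "b\<^sup>2 - r\<^sup>2 \<ge> 0" using r ab by (auto intro: power_mono)
    \<comment> \<open>With \<open>\<epsilon> = e / (b\<^sup>2 + 1)\<close> the error term of
      \<open>eps\<close> is at most \<open>e\<close>.\<close>
    then have "e / (b\<^sup>2 + 1) * (b\<^sup>2 - r\<^sup>2) \<le> e / (b\<^sup>2 + 1) * (b\<^sup>2 + 1)"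
      using \<open>e > 0\<close> by (intro mult_left_mono) (auto intro: order_trans[OF _ zero_le_power2])
    also have "\<dots> = e" by (simp add: add_nonneg_eq_0_iff)
    finally show "\<psi> r t \<le> m + e"
      using eps[of "e / (b\<^sup>2 + 1)"] \<open>e > 0\<close> by (simp add: add_nonneg_pos)
  qed
qed

section \<open>Gradient of a harmonic function\<close>

text \<open>With \<open>g\<close> the derivative of \<open>h\<close>, this is the second derivative
  of \<open>ln (1 + h)\<close>; it serves both polar directions in the three circles
  inequality.\<close>

lemma has_derivative_log_derivative:
  fixes g h :: "real \<Rightarrow> real"
  assumes h: "(h has_real_derivative g x) (at x)" and g: "(g has_real_derivative D) (at x)"
    and pos: "1 + h x > 0"
  shows "((\<lambda>s. g s / (1 + h s)) has_real_derivative D / (1 + h x) - (g x)\<^sup>2 / (1 + h x)\<^sup>2) (at x)"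
proof -
  have "((\<lambda>s. g s / (1 + h s)) has_real_derivative
      (D * (1 + h x) - g x * (0 + g x)) / ((1 + h x) * (1 + h x))) (at x)"
    using pos by (intro DERIV_divide g DERIV_add h DERIV_const) auto
  then show ?thesis
    using pos by (simp add: diff_divide_distrib power2_eq_square)
qed

lemma periodic_bounded:
  fixes g :: "real \<Rightarrow> real"
  assumes "continuous_on UNIV g" and per: "\<And>t. g (t + 2 * pi) = g t"
  obtains B where "\<And>t. \<bar>g t\<bar> \<le> B"
proof -
  have "compact (g ` {0..2*pi})"
    by (intro compact_continuous_image continuous_on_subset[OF assms(1)]) auto
  then have "bounded (g ` {0..2*pi})" by (rule compact_imp_bounded)
  then obtain B where B: "\<And>t. t \<in> {0..2*pi} \<Longrightarrow> \<bar>g t\<bar> \<le> B"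
    unfolding bounded_iff by fastforce
  have "\<bar>g t\<bar> \<le> B" for t
  proof -
    obtain s where "0 \<le> s" "s < 2 * pi" "g s = g t"
      by (rule periodic_reduce[of g t]) (auto simp: per)
    then show ?thesis using B[of s] by simp
  qed
  then show ?thesis by (rule that)
qed

text \<open>The algebraic core of Bernstein's method: \<open>(x, y)\<close> is the gradient,
  \<open>(x', y')\<close> its radial derivative, \<open>k\<close> is \<open>f'/f\<close>. Adding
  \<open>4 * \<eta>'\<^sup>2 * (x\<^sup>2 + y\<^sup>2)\<close> completes squares; what remains costs
  at most \<open>18 + 12 + 18 = 48\<close> multiples of \<open>R\<^sup>2\<close>, which
  \<open>50\<close> covers.\<close>

lemma cutoff_inequality:
  fixes R \<eta> \<eta>' k x y x' y' :: real
  assumes "R > 0" "0 \<le> \<eta>" "\<eta> \<le> 3 * R\<^sup>2" "\<bar>\<eta>'\<bar> \<le> 3 * R" "0 \<le> k" "k \<le> 1 / R"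
  shows "4 * \<eta>\<^sup>2 * (x'\<^sup>2 + y'\<^sup>2) + 8 * \<eta> * \<eta>' * (x * x' + y * y')
    + (x\<^sup>2 + y\<^sup>2) * (2 * \<eta>'\<^sup>2 - 4 * \<eta> + 2 * k * \<eta> * \<eta>' + 50 * R\<^sup>2) \<ge> 0"
proof -
  have "\<bar>k * \<eta> * \<eta>'\<bar> \<le> 1 / R * (3 * R\<^sup>2) * (3 * R)"
    unfolding abs_mult using assms by (intro mult_mono) auto
  then have 1: "- 9 * R\<^sup>2 \<le> k * \<eta> * \<eta>'"
    using \<open>R > 0\<close> by (simp add: power2_eq_square abs_le_iff)
  have "\<bar>\<eta>'\<bar>\<^sup>2 \<le> (3 * R)\<^sup>2" using assms by (intro power_mono) auto
  then have 2: "\<eta>'\<^sup>2 \<le> 9 * R\<^sup>2" by (simp add: power_mult_distrib)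
  have "- 2 * \<eta>'\<^sup>2 - 4 * \<eta> + 2 * (k * \<eta> * \<eta>') + 50 * R\<^sup>2 \<ge> 0"
    using 1 2 assms(3) zero_le_power2[of R] by linarith
  then have "(x\<^sup>2 + y\<^sup>2) * (- 2 * \<eta>'\<^sup>2 - 4 * \<eta> + 2 * (k * \<eta> * \<eta>') + 50 * R\<^sup>2) \<ge> 0"
    by (intro mult_nonneg_nonneg) auto
  moreover have "4 * ((\<eta> * x' + \<eta>' * x)\<^sup>2 + (\<eta> * y' + \<eta>' * y)\<^sup>2) \<ge> 0" by simp
  ultimately show ?thesis by (simp add: algebra_simps power2_eq_square)
qed

text \<open>The setting on the punctured plane: \<open>U\<close> stands for u in polar coordinates,
  and the two limits make \<open>f\<close> behave like \<open>r\<close> at the origin.\<close>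

locale polar_harmonic =
  fixes f U :: "real \<Rightarrow> real \<Rightarrow> real"
  assumes f_pos: "\<And>r t. r > 0 \<Longrightarrow> f r t > 0"
    and f_smooth: "smooth_polar f"
    and f_periodic: "\<And>r t. r > 0 \<Longrightarrow> f r (t + 2 * pi) = f r t"
    and f_lim0: "\<And>t. ((\<lambda>r. f r t) \<longlongrightarrow> 0) (at_right 0)"
    and f'_lim0: "\<And>t. ((\<lambda>r. dr f r t) \<longlongrightarrow> 1) (at_right 0)"
    and K_nonneg: "\<And>r t. r > 0 \<Longrightarrow> curv f r t \<ge> 0"
    and U_smooth: "smooth_polar U"
    and U_periodic: "\<And>r t. r > 0 \<Longrightarrow> U r (t + 2 * pi) = U r t"
    and U_harm: "\<And>r t. r > 0 \<Longrightarrow> lap_g f U r t = 0"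
begin

section \<open>Consequences of nonnegative curvature for \<open>f\<close>\<close>

lemma f_concave: "r > 0 \<Longrightarrow> dr (dr f) r t \<le> 0"
  using K_nonneg[of r t] f_pos[of r t] by (simp add: curv_def divide_le_0_iff zero_le_divide_iff)

text \<open>A concave function lies below its tangents. If the slope at \<open>r\<close> were
  negative, the tangent there would reach zero at \<open>s\<close>, against positivity of
  \<open>f\<close>.\<close>

lemma dr_f_nonneg:
  assumes "r > 0"
  shows "dr f r t \<ge> 0"
proof (rule ccontr)
  assume neg: "\<not> ?thesis"
  define s where "s = r + f r t / (- dr f r t)"
  have fr: "f r t > 0" using f_pos assms .
  have s: "s > r" using neg fr by (simp add: s_def divide_pos_neg)
  obtain z where z: "r < z" "z < s" "f s t - f r t = (s - r) * dr f z t"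
    using MVT2[OF s, of "\<lambda>r. f r t" "\<lambda>r. dr f r t"] assms smooth_polar_has_dr[OF f_smooth] by force
  have "dr f z t \<le> dr f r t"
  proof (rule DERIV_nonpos_imp_nonincreasing[of r z "\<lambda>r. dr f r t"])
    show "\<exists>y. ((\<lambda>r. dr f r t) has_real_derivative y) (at x) \<and> y \<le> 0" if "r \<le> x" for x
      using that assms f_concave[of x t] smooth_polar_has_dr[OF smooth_polar_dr[OF f_smooth], of x t]
      by auto
  qed (use z in simp)
  then have "f s t - f r t \<le> (s - r) * dr f r t" using z s by simp
  also have "\<dots> = - f r t" using neg by (simp add: s_def field_simps)
  finally show False using f_pos[of s t] s assms by simp
qed

text \<open>By concavity \<open>f - r * dr f\<close> has the nonnegative derivative
  \<open>- r * dr (dr f)\<close>, and it tends to \<open>0\<close> at the origin.\<close>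

lemma dr_f_le:
  assumes "r > 0"
  shows "r * dr f r t \<le> f r t"
proof -
  let ?g = "\<lambda>s. f s t - s * dr f s t"
  have "(?g \<longlongrightarrow> 0 - 0 * 1) (at_right 0)"
    by (intro tendsto_intros f_lim0 f'_lim0)
  then have lim: "(?g \<longlongrightarrow> 0) (at_right 0)" by simp
  have "?g s \<le> ?g r" if "0 < s" "s < r" for s
  proof (rule DERIV_nonneg_imp_nondecreasing[of s r ?g])
    show "\<exists>y. (?g has_real_derivative y) (at x) \<and> 0 \<le> y" if "s \<le> x" "x \<le> r" for x
    proof (intro exI conjI)
      have x: "x > 0" using that \<open>0 < s\<close> by simp
      show "(?g has_real_derivative - (x * dr (dr f) x t)) (at x)"
        using x by (auto intro!: derivative_eq_intros smooth_polar_has_dr smooth_polar_dr f_smooth)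
      show "0 \<le> - (x * dr (dr f) x t)"
        using x f_concave[of x t] by (simp add: mult_nonneg_nonpos)
    qed
  qed (use that in simp)
  then have "eventually (\<lambda>s. ?g s \<le> ?g r) (at_right 0)"
    unfolding eventually_at_right_field using assms by blast
  then have "0 \<le> ?g r"
    by (intro tendsto_upperbound[OF lim]) auto
  then show ?thesis by simp
qed

text \<open>\<open>dr f / f\<close> is the Laplacian of the distance \<open>r\<close>. The lower
  bound is the sign condition on \<open>k\<close> in the maximum principle; the upper one is
  Laplacian comparison with the Euclidean plane.\<close>

lemma dr_f_quotient:
  assumes "r > 0"
  shows "0 \<le> dr f r t / f r t" "dr f r t / f r t \<le> 1 / r"
  using dr_f_nonneg[OF assms, of t] dr_f_le[OF assms, of t] f_pos[OF assms, of t] assms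
  by (auto simp: field_simps)

text \<open>\<open>X\<close> and \<open>Y\<close> are the components of the gradient of \<open>U\<close> in the orthonormal frame
  \<open>\<partial>\<^sub>r\<close>, \<open>f\<^sup>-\<^sup>1 \<partial>\<^sub>\<theta>\<close>; in these terms the equation \<open>\<Delta>U = 0\<close> becomes the Cauchy--Riemann type system
  \<open>\<partial>\<^sub>\<theta> X = \<partial>\<^sub>r (f Y)\<close>, \<open>\<partial>\<^sub>\<theta> Y = - \<partial>\<^sub>r (f X)\<close>. The suffixes \<open>r\<close> and \<open>t\<close> mark the explicit partial
  derivatives.\<close>

definition X :: "real \<Rightarrow> real \<Rightarrow> real" where "X = dr U"
definition Xr :: "real \<Rightarrow> real \<Rightarrow> real" where "Xr = dr (dr U)"
definition Xrr :: "real \<Rightarrow> real \<Rightarrow> real" where "Xrr = dr (dr (dr U))"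

text \<open>A name for the reciprocal of \<open>f\<close> turns the identities below into polynomial
  ones modulo \<open>f * w = 1\<close>.\<close>

definition w :: "real \<Rightarrow> real \<Rightarrow> real" where "w r t = inverse (f r t)"

definition Y :: "real \<Rightarrow> real \<Rightarrow> real" where "Y r t = dt U r t * w r t"
definition Yr :: "real \<Rightarrow> real \<Rightarrow> real" where
  "Yr r t = dt (dr U) r t * w r t - dt U r t * dr f r t * (w r t)\<^sup>2"
definition Yrr :: "real \<Rightarrow> real \<Rightarrow> real" where
  "Yrr r t = dt (dr (dr U)) r t * w r t - 2 * dt (dr U) r t * dr f r t * (w r t)\<^sup>2
     - dt U r t * dr (dr f) r t * (w r t)\<^sup>2 + 2 * dt U r t * (dr f r t)\<^sup>2 * (w r t)^3"

lemma f_w: "r > 0 \<Longrightarrow> f r t * w r t = 1"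
  using f_pos[of r t] by (simp add: w_def)

lemmas smooth_intros = smooth_polar_has_dr smooth_polar_has_dt
  smooth_polar_dr smooth_polar_dt f_smooth U_smooth

lemma w_r: "r > 0 \<Longrightarrow> ((\<lambda>s. w s t) has_real_derivative - dr f r t * (w r t)\<^sup>2) (at r)"
  unfolding w_def using f_pos[of r t]
  by (auto intro!: derivative_eq_intros smooth_intros simp: power2_eq_square)

lemma w_t: "r > 0 \<Longrightarrow> ((\<lambda>s. w r s) has_real_derivative - dt f r t * (w r t)\<^sup>2) (at t)"
  unfolding w_def using f_pos[of r t]
  by (auto intro!: derivative_eq_intros smooth_intros simp: power2_eq_square)

lemma X_r: "r > 0 \<Longrightarrow> ((\<lambda>s. X s t) has_real_derivative Xr r t) (at r)"
  unfolding X_def Xr_def by (intro smooth_intros)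

lemma Xr_r: "r > 0 \<Longrightarrow> ((\<lambda>s. Xr s t) has_real_derivative Xrr r t) (at r)"
  unfolding Xr_def Xrr_def by (intro smooth_intros)

lemma Y_r:
  assumes "r > 0"
  shows "((\<lambda>s. Y s t) has_real_derivative Yr r t) (at r)"
  unfolding Y_def Yr_def using assms
  by (auto intro!: derivative_eq_intros smooth_intros w_r
      simp: dr_dt_commute[OF U_smooth assms])

lemma Yr_r:
  assumes "r > 0"
  shows "((\<lambda>s. Yr s t) has_real_derivative Yrr r t) (at r)"
proof -
  have "dr (dt (dr U)) r t = dt (dr (dr U)) r t"
    by (intro dr_dt_commute smooth_polar_dr U_smooth assms)
  then show ?thesis
    unfolding Yr_def Yrr_def using assms
    by (auto intro!: derivative_eq_intros smooth_intros w_r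
        simp: dr_dt_commute[OF U_smooth assms] algebra_simps power2_eq_square power3_eq_cube)
qed

lemma X_t:
  assumes "r > 0"
  shows "((\<lambda>s. X r s) has_real_derivative f r t * Yr r t + dr f r t * Y r t) (at t)"
proof -
  have "((\<lambda>s. X r s) has_real_derivative dt (dr U) r t) (at t)"
    unfolding X_def by (intro smooth_intros assms)
  moreover have "dt (dr U) r t = f r t * Yr r t + dr f r t * Y r t"
    using f_w[OF assms, of t] unfolding Y_def Yr_def by algebra
  ultimately show ?thesis by simp
qed

text \<open>Multiplying the equation \<open>lap_g f U = 0\<close> by \<open>f\<close> gathers its
  angular terms into the product rule for \<open>Y = dt U * w\<close>.\<close>

lemma harmonic_first_order:
  assumes "r > 0"
  shows "dt (dt U) r t * w r t - dt U r t * dt f r t * (w r t)\<^sup>2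
    = - f r t * Xr r t - dr f r t * X r t"
proof -
  have "lap_g f U r t = Xr r t + dr f r t * w r t * X r t + dt (dt U) r t * (w r t)\<^sup>2
      - dt f r t * (w r t)^3 * dt U r t"
    by (simp add: lap_g_def X_def Xr_def w_def divide_inverse power_inverse)
  then show ?thesis
    using f_w[OF assms, of t] U_harm[OF assms, of t] by algebra
qed

lemma Y_t:
  assumes "r > 0"
  shows "((\<lambda>s. Y r s) has_real_derivative - f r t * Xr r t - dr f r t * X r t) (at t)"
  unfolding Y_def harmonic_first_order[OF assms, symmetric] using assms
  by (auto intro!: derivative_eq_intros smooth_intros w_t)

text \<open>The right side is the radial derivative of the one in \<open>X_t\<close>.\<close>

lemma Xr_t:
  assumes "r > 0"
  shows "((\<lambda>s. Xr r s) has_real_derivative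
    2 * dr f r t * Yr r t + f r t * Yrr r t + dr (dr f) r t * Y r t) (at t)"
proof -
  have "((\<lambda>s. Xr r s) has_real_derivative dt (dr (dr U)) r t) (at t)"
    unfolding Xr_def by (intro smooth_intros assms)
  moreover have "dt (dr (dr U)) r t
      = 2 * dr f r t * Yr r t + f r t * Yrr r t + dr (dr f) r t * Y r t"
    using f_w[OF assms, of t] unfolding Y_def Yr_def Yrr_def by algebra
  ultimately show ?thesis by simp
qed

text \<open>The harmonic equation differentiated radially: both sides of
  \<open>harmonic_first_order\<close> have the same radial derivative, and commuting partial
  derivatives identifies the left one with \<open>D\<close>, the angular derivative of
  \<open>Yr\<close>.\<close>

lemma Yr_t:
  assumes "r > 0"
  shows "((\<lambda>s. Yr r s) has_real_derivative
    - 2 * dr f r t * Xr r t - f r t * Xrr r t - dr (dr f) r t * X r t) (at t)"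
proof -
  define D where "D = dt (dt (dr U)) r t * w r t - dt (dr U) r t * dt f r t * (w r t)\<^sup>2
    - dt (dt U) r t * dr f r t * (w r t)\<^sup>2 - dt U r t * dt (dr f) r t * (w r t)\<^sup>2
    + 2 * dt U r t * dr f r t * dt f r t * (w r t)^3"
  have "((\<lambda>s. Yr r s) has_real_derivative D) (at t)"
    unfolding Yr_def D_def using assms
    by (auto intro!: derivative_eq_intros smooth_intros w_t
        simp: algebra_simps power2_eq_square power3_eq_cube)
  moreover have "D = - 2 * dr f r t * Xr r t - f r t * Xrr r t - dr (dr f) r t * X r t"
  proof (rule DERIV_unique)
    let ?h = "\<lambda>s. dt (dt U) s t * w s t - dt U s t * dt f s t * (w s t)\<^sup>2"
    have "dr (dt (dt U)) r t = dt (dr (dt U)) r t"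
      by (intro dr_dt_commute smooth_polar_dt U_smooth assms)
    also have "\<dots> = dt (dt (dr U)) r t"
      unfolding dt_def[of "dr (dt U)"] dr_dt_commute[OF U_smooth assms] by (simp add: dt_def)
    finally show "(?h has_real_derivative D) (at r)"
      unfolding D_def using assms
      by (auto intro!: derivative_eq_intros smooth_intros w_r
          simp: dr_dt_commute[OF U_smooth assms] dr_dt_commute[OF f_smooth assms]
            algebra_simps power2_eq_square power3_eq_cube)
    have "((\<lambda>s. - f s t * Xr s t - dr f s t * X s t) has_real_derivative
        - 2 * dr f r t * Xr r t - f r t * Xrr r t - dr (dr f) r t * X r t) (at r)"
      using assms by (auto intro!: derivative_eq_intros smooth_intros X_r Xr_r)
    then show "(?h has_real_derivative
        - 2 * dr f r t * Xr r t - f r t * Xrr r t - dr (dr f) r t * X r t) (at r)"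
      by (rule has_field_derivative_transform_within_open[of _ _ _ "{0<..}"])
         (use assms in \<open>auto simp: harmonic_first_order\<close>)
  qed
  ultimately show ?thesis by simp
qed

section \<open>The squared gradient and its derivatives\<close>

definition q :: "real \<Rightarrow> real \<Rightarrow> real" where "q r t = (X r t)\<^sup>2 + (Y r t)\<^sup>2"
definition qr :: "real \<Rightarrow> real \<Rightarrow> real" where "qr r t = 2 * (X r t * Xr r t + Y r t * Yr r t)"
definition qrr :: "real \<Rightarrow> real \<Rightarrow> real" where
  "qrr r t = 2 * ((Xr r t)\<^sup>2 + (Yr r t)\<^sup>2 + X r t * Xrr r t + Y r t * Yrr r t)"
text \<open>The Cauchy-Riemann type system has been inserted into
  \<open>2 * (X * dt X + Y * dt Y)\<close>; the terms with \<open>dr f\<close> cancel.\<close>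

definition qt :: "real \<Rightarrow> real \<Rightarrow> real" where
  "qt r t = 2 * f r t * (X r t * Yr r t - Y r t * Xr r t)"
definition qtt :: "real \<Rightarrow> real \<Rightarrow> real" where
  "qtt r t = 2 * dt f r t * (X r t * Yr r t - Y r t * Xr r t)
     + 2 * f r t * ((f r t * Yr r t + dr f r t * Y r t) * Yr r t
       + X r t * (- 2 * dr f r t * Xr r t - f r t * Xrr r t - dr (dr f) r t * X r t)
       - (- f r t * Xr r t - dr f r t * X r t) * Xr r t
       - Y r t * (2 * dr f r t * Yr r t + f r t * Yrr r t + dr (dr f) r t * Y r t))"

lemma q_nonneg: "q r t \<ge> 0"
  by (simp add: q_def)

lemma q_r: "r > 0 \<Longrightarrow> ((\<lambda>s. q s t) has_real_derivative qr r t) (at r)"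
  unfolding q_def qr_def by (auto intro!: derivative_eq_intros X_r Y_r)

lemma qr_r: "r > 0 \<Longrightarrow> ((\<lambda>s. qr s t) has_real_derivative qrr r t) (at r)"
  unfolding qr_def qrr_def
  by (auto intro!: derivative_eq_intros X_r Y_r Xr_r Yr_r simp: power2_eq_square)

lemma q_t: "r > 0 \<Longrightarrow> ((\<lambda>s. q r s) has_real_derivative qt r t) (at t)"
  unfolding q_def qt_def
  by (rule derivative_eq_intros X_t Y_t refl | assumption | simp add: algebra_simps)+

lemma qt_t: "r > 0 \<Longrightarrow> ((\<lambda>s. qt r s) has_real_derivative qtt r t) (at t)"
  unfolding qt_def qtt_def
  by (rule derivative_eq_intros smooth_polar_has_dt[OF f_smooth] X_t Y_t Xr_t Yr_t refl
      | assumption | simp add: algebra_simps)+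

text \<open>In dimension two a harmonic function has a trace-free Hessian, so the Bochner formula for
  \<open>q = |\<nabla>u|\<^sup>2\<close> and the norm of \<open>\<nabla>q\<close> involve only the entries \<open>Xr\<close> and \<open>Yr\<close>.\<close>

lemma bochner:
  assumes "r > 0"
  shows "qrr r t + dr f r t / f r t * qr r t + 1 / (f r t)\<^sup>2 * qtt r t
      + - (dt f r t / (f r t)^3) * qt r t
    = 4 * ((Xr r t)\<^sup>2 + (Yr r t)\<^sup>2) + 2 * curv f r t * q r t"
proof -
  have "qrr r t + dr f r t * w r t * qr r t + (w r t)\<^sup>2 * qtt r t - dt f r t * (w r t)^3 * qt r t
    = 4 * ((Xr r t)\<^sup>2 + (Yr r t)\<^sup>2) - 2 * (dr (dr f) r t * w r t) * q r t"
    using f_w[OF assms, of t] unfolding q_def qr_def qrr_def qt_def qtt_def by algebra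
  then show ?thesis
    by (simp add: curv_def w_def divide_inverse power_inverse)
qed

lemma grad_q:
  assumes "r > 0"
  shows "(qr r t)\<^sup>2 + 1 / (f r t)\<^sup>2 * (qt r t)\<^sup>2 = 4 * q r t * ((Xr r t)\<^sup>2 + (Yr r t)\<^sup>2)"
proof -
  have "(qr r t)\<^sup>2 + (w r t)\<^sup>2 * (qt r t)\<^sup>2 = 4 * q r t * ((Xr r t)\<^sup>2 + (Yr r t)\<^sup>2)"
    using f_w[OF assms, of t] unfolding q_def qr_def qt_def by algebra
  then show ?thesis by (simp add: w_def divide_inverse power_inverse)
qed

section \<open>Maximum principle for the Laplacian of the metric, and its applications\<close>

lemmas subharmonic_le_boundary = annulus_maximum_principle
  [where k = "\<lambda>r t. dr f r t / f r t" and \<alpha> = "\<lambda>r t. 1 / (f r t)\<^sup>2"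
     and \<beta> = "\<lambda>r t. - (dt f r t / (f r t)^3)"]

lemma q_periodic: "r > 0 \<Longrightarrow> q r (t + 2 * pi) = q r t"
  unfolding q_def X_def Y_def w_def
  by (simp add: f_periodic dr_periodic[OF U_smooth U_periodic] dt_periodic[OF U_smooth U_periodic])

lemma U_continuous: "A \<subseteq> {0<..} \<times> UNIV \<Longrightarrow> continuous_on A (\<lambda>x. U (fst x) (snd x))"
  using smooth_polar_continuous[OF U_smooth]
  by (auto simp: case_prod_unfold intro: continuous_on_subset)

lemma q_continuous:
  assumes "A \<subseteq> {0<..} \<times> UNIV"
  shows "continuous_on A (\<lambda>x. q (fst x) (snd x))"
proof -
  have c: "continuous_on A (\<lambda>x. F (fst x) (snd x))" if "smooth_polar F" for F
    using smooth_polar_continuous[OF that] assms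
    by (auto simp: case_prod_unfold intro: continuous_on_subset)
  have "f (fst x) (snd x) \<noteq> 0" if "x \<in> A" for x
    using f_pos[of "fst x" "snd x"] that assms by force
  then show ?thesis
    unfolding q_def X_def Y_def w_def
    by (intro continuous_intros c f_smooth smooth_polar_dr smooth_polar_dt U_smooth) auto
qed

text \<open>The maximum principle applies to both \<open>U\<close> and \<open>-U\<close>; the factor
  \<open>c\<close> carries the sign.\<close>

lemma abs_U_le_boundary:
  assumes "0 < a" "a \<le> r" "r \<le> b" and bd: "\<And>t. \<bar>U a t\<bar> \<le> m" "\<And>t. \<bar>U b t\<bar> \<le> m"
  shows "\<bar>U r t\<bar> \<le> m"
proof -
  have "c * U r t \<le> m" if c: "c = 1 \<or> c = -1" for c
  proof (rule subharmonic_le_boundary[where \<psi> = "\<lambda>r t. c * U r t" and a = a and b = b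
        and \<psi>r = "\<lambda>r t. c * dr U r t" and \<psi>rr = "\<lambda>r t. c * dr (dr U) r t"
        and \<psi>t = "\<lambda>r t. c * dt U r t" and \<psi>tt = "\<lambda>r t. c * dt (dt U) r t"])
    show "continuous_on ({a..b} \<times> UNIV) (\<lambda>(r, t). c * U r t)"
      unfolding case_prod_unfold using \<open>0 < a\<close> by (intro continuous_intros U_continuous) auto
    show "c * dr (dr U) r t + dr f r t / f r t * (c * dr U r t)
        + 1 / (f r t)\<^sup>2 * (c * dt (dt U) r t) + - (dt f r t / f r t ^ 3) * (c * dt U r t) \<ge> 0"
      if "a < r" "r < b" for r t
    proof -
      have "c * lap_g f U r t = 0" using U_harm[of r t] that \<open>0 < a\<close> by simp
      then show ?thesis by (simp add: lap_g_def algebra_simps)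
    qed
    show "c * U a t \<le> m" "c * U b t \<le> m" for t
      using c bd[of t] by (auto simp: abs_le_iff)
  qed (use assms in \<open>auto intro!: DERIV_cmult smooth_intros dr_f_quotient simp: U_periodic\<close>)
  from this[of 1] this[of "-1"] show ?thesis by auto
qed

text \<open>Bernstein's method: \<open>\<eta>\<^sup>2 |\<nabla>u|\<^sup>2 + 25 R\<^sup>2 u\<^sup>2\<close> is subharmonic for the radial cutoff
  \<open>\<eta> = (r - R) (4R - r)\<close>, which vanishes on the boundary of the annulus \<open>R \<le> r \<le> 4R\<close>.\<close>

lemma gradient_estimate:
  assumes "R > 0" and bd: "\<And>t. \<bar>U R t\<bar> \<le> S" "\<And>t. \<bar>U (4 * R) t\<bar> \<le> S"
  shows "4 * R\<^sup>2 * q (2 * R) t \<le> 25 * S\<^sup>2"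
proof -
  define \<eta> where "\<eta> r = (r - R) * (4 * R - r)" for r
  define \<eta>' where "\<eta>' r = 5 * R - 2 * r" for r
  have \<eta>: "(\<eta> has_real_derivative \<eta>' r) (at r)" for r
    unfolding \<eta>_def \<eta>'_def by (auto intro!: derivative_eq_intros simp: algebra_simps)
  have \<eta>': "(\<eta>' has_real_derivative -2) (at r)" for r
    unfolding \<eta>'_def by (auto intro!: derivative_eq_intros)
  have sq: "(U s t)\<^sup>2 \<le> S\<^sup>2" if "\<bar>U s t\<bar> \<le> S" for s t
    using power_mono[OF that, of 2] by simp
  have "(\<eta> (2 * R))\<^sup>2 * q (2 * R) t + 25 * R\<^sup>2 * (U (2 * R) t)\<^sup>2 \<le> 25 * R\<^sup>2 * S\<^sup>2"
  proof (rule subharmonic_le_boundary[where a = R and b = "4 * R"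
        and \<psi> = "\<lambda>r t. (\<eta> r)\<^sup>2 * q r t + 25 * R\<^sup>2 * (U r t)\<^sup>2"
        and \<psi>r = "\<lambda>r t. 2 * \<eta> r * \<eta>' r * q r t + (\<eta> r)\<^sup>2 * qr r t + 50 * R\<^sup>2 * U r t * X r t"
        and \<psi>rr = "\<lambda>r t. (2 * (\<eta>' r)\<^sup>2 - 4 * \<eta> r) * q r t + 4 * \<eta> r * \<eta>' r * qr r t
          + (\<eta> r)\<^sup>2 * qrr r t + 50 * R\<^sup>2 * ((X r t)\<^sup>2 + U r t * Xr r t)"
        and \<psi>t = "\<lambda>r t. (\<eta> r)\<^sup>2 * qt r t + 50 * R\<^sup>2 * U r t * dt U r t"
        and \<psi>tt = "\<lambda>r t. (\<eta> r)\<^sup>2 * qtt r t + 50 * R\<^sup>2 * ((dt U r t)\<^sup>2 + U r t * dt (dt U) r t)"])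
    show "continuous_on ({R..4 * R} \<times> UNIV) (\<lambda>(r, t). (\<eta> r)\<^sup>2 * q r t + 25 * R\<^sup>2 * (U r t)\<^sup>2)"
      unfolding case_prod_unfold \<eta>_def using \<open>R > 0\<close>
      by (intro continuous_intros U_continuous q_continuous) auto
    show "(\<eta> r)\<^sup>2 * q r (t + 2 * pi) + 25 * R\<^sup>2 * (U r (t + 2 * pi))\<^sup>2
        = (\<eta> r)\<^sup>2 * q r t + 25 * R\<^sup>2 * (U r t)\<^sup>2" if "R \<le> r" for r t
      using that \<open>R > 0\<close> by (simp add: q_periodic U_periodic)
    fix r t assume "R < r" "r < 4 * R"
    then have r: "r > 0" using \<open>R > 0\<close> by simp
    show "((\<lambda>s. (\<eta> s)\<^sup>2 * q s t + 25 * R\<^sup>2 * (U s t)\<^sup>2) has_real_derivative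
        2 * \<eta> r * \<eta>' r * q r t + (\<eta> r)\<^sup>2 * qr r t + 50 * R\<^sup>2 * U r t * X r t) (at r)"
      unfolding X_def
      by (rule derivative_eq_intros \<eta> q_r smooth_polar_has_dr[OF U_smooth] r refl | simp)+
    show "((\<lambda>s. 2 * \<eta> s * \<eta>' s * q s t + (\<eta> s)\<^sup>2 * qr s t + 50 * R\<^sup>2 * U s t * X s t)
        has_real_derivative (2 * (\<eta>' r)\<^sup>2 - 4 * \<eta> r) * q r t + 4 * \<eta> r * \<eta>' r * qr r t
          + (\<eta> r)\<^sup>2 * qrr r t + 50 * R\<^sup>2 * ((X r t)\<^sup>2 + U r t * Xr r t)) (at r)"
      by (rule derivative_eq_intros \<eta> \<eta>' q_r qr_r X_r smooth_polar_has_dr[OF U_smooth] r refl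
          | simp add: X_def[symmetric] algebra_simps power2_eq_square)+
    show "((\<lambda>s. (\<eta> r)\<^sup>2 * q r s + 25 * R\<^sup>2 * (U r s)\<^sup>2) has_real_derivative
        (\<eta> r)\<^sup>2 * qt r t + 50 * R\<^sup>2 * U r t * dt U r t) (at t)"
      by (rule derivative_eq_intros q_t smooth_polar_has_dt[OF U_smooth] r refl | simp)+
    show "((\<lambda>s. (\<eta> r)\<^sup>2 * qt r s + 50 * R\<^sup>2 * U r s * dt U r s) has_real_derivative
        (\<eta> r)\<^sup>2 * qtt r t + 50 * R\<^sup>2 * ((dt U r t)\<^sup>2 + U r t * dt (dt U) r t)) (at t)"
      by (rule derivative_eq_intros qt_t smooth_polar_has_dt[OF U_smooth]
          smooth_polar_has_dt[OF smooth_polar_dt[OF U_smooth]] r refl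
          | simp add: algebra_simps power2_eq_square)+
    show "0 \<le> dr f r t / f r t" using dr_f_quotient r by blast
    show "(2 * (\<eta>' r)\<^sup>2 - 4 * \<eta> r) * q r t + 4 * \<eta> r * \<eta>' r * qr r t
          + (\<eta> r)\<^sup>2 * qrr r t + 50 * R\<^sup>2 * ((X r t)\<^sup>2 + U r t * Xr r t)
        + dr f r t / f r t
          * (2 * \<eta> r * \<eta>' r * q r t + (\<eta> r)\<^sup>2 * qr r t + 50 * R\<^sup>2 * U r t * X r t)
        + 1 / (f r t)\<^sup>2
          * ((\<eta> r)\<^sup>2 * qtt r t + 50 * R\<^sup>2 * ((dt U r t)\<^sup>2 + U r t * dt (dt U) r t))
        + - (dt f r t / f r t ^ 3) * ((\<eta> r)\<^sup>2 * qt r t + 50 * R\<^sup>2 * U r t * dt U r t) \<ge> 0"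
      (is "?L \<ge> 0")
    proof -
      define k \<alpha> \<beta> where "k = dr f r t / f r t" and "\<alpha> = 1 / (f r t)\<^sup>2"
        and "\<beta> = dt f r t / f r t ^ 3"
      define H where "H = (Xr r t)\<^sup>2 + (Yr r t)\<^sup>2"
      have harm: "Xr r t + k * X r t + \<alpha> * dt (dt U) r t - \<beta> * dt U r t = 0"
        using U_harm[OF r, of t] by (simp add: lap_g_def Xr_def X_def k_def \<alpha>_def \<beta>_def)
      have boch: "qrr r t + k * qr r t + \<alpha> * qtt r t - \<beta> * qt r t = 4 * H + 2 * curv f r t * q r t"
        using bochner[OF r, of t] by (simp add: k_def \<alpha>_def \<beta>_def H_def)
      have qXY: "q r t = (X r t)\<^sup>2 + \<alpha> * (dt U r t)\<^sup>2"
        by (simp add: q_def Y_def w_def \<alpha>_def power_mult_distrib power_inverse divide_inverse)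
      \<comment> \<open>The grouping exhibits the Laplacians of \<open>q\<close> and
        \<open>U\<close>, which become the Bochner expression and \<open>0\<close>; the gradient of
        \<open>U\<close> squared yields the helpful term \<open>50 * R\<^sup>2 * q\<close>.\<close>
      have "?L = (\<eta> r)\<^sup>2 * (qrr r t + k * qr r t + \<alpha> * qtt r t - \<beta> * qt r t)
          + 4 * \<eta> r * \<eta>' r * qr r t + q r t * (2 * (\<eta>' r)\<^sup>2 - 4 * \<eta> r + 2 * k * \<eta> r * \<eta>' r)
          + 50 * R\<^sup>2 * (((X r t)\<^sup>2 + \<alpha> * (dt U r t)\<^sup>2)
            + U r t * (Xr r t + k * X r t + \<alpha> * dt (dt U) r t - \<beta> * dt U r t))"
        unfolding k_def[symmetric] \<alpha>_def[symmetric] \<beta>_def[symmetric]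
        by (simp add: algebra_simps)
      also have "\<dots> = (4 * (\<eta> r)\<^sup>2 * H + 8 * \<eta> r * \<eta>' r * (X r t * Xr r t + Y r t * Yr r t)
          + q r t * (2 * (\<eta>' r)\<^sup>2 - 4 * \<eta> r + 2 * k * \<eta> r * \<eta>' r + 50 * R\<^sup>2))
          + 2 * ((\<eta> r)\<^sup>2 * (curv f r t * q r t))"
        unfolding harm boch qXY[symmetric] by (simp add: qr_def algebra_simps)
      also have "\<dots> \<ge> 0"
      proof (rule add_nonneg_nonneg)
        have "\<eta> r \<ge> 0" using \<open>R < r\<close> \<open>r < 4 * R\<close> by (simp add: \<eta>_def)
        moreover have "3 * R\<^sup>2 - \<eta> r = (r - 5/2 * R)\<^sup>2 + 3/4 * R\<^sup>2"
          by (simp add: \<eta>_def algebra_simps power2_eq_square)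
        then have "\<eta> r \<le> 3 * R\<^sup>2"
          using zero_le_power2[of R] zero_le_power2[of "r - 5/2 * R"] by linarith
        moreover have "\<bar>\<eta>' r\<bar> \<le> 3 * R" using \<open>R < r\<close> \<open>r < 4 * R\<close> by (auto simp: \<eta>'_def)
        moreover have "1 / r \<le> 1 / R" using \<open>R < r\<close> \<open>R > 0\<close> by (simp add: frac_le)
        then have "k \<le> 1 / R" using dr_f_quotient(2)[OF r, of t] unfolding k_def by linarith
        moreover have "k \<ge> 0" using dr_f_quotient(1)[OF r, of t] by (simp add: k_def)
        ultimately show "0 \<le> 4 * (\<eta> r)\<^sup>2 * H + 8 * \<eta> r * \<eta>' r * (X r t * Xr r t + Y r t * Yr r t)
          + q r t * (2 * (\<eta>' r)\<^sup>2 - 4 * \<eta> r + 2 * k * \<eta> r * \<eta>' r + 50 * R\<^sup>2)"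
          unfolding H_def q_def using \<open>R > 0\<close> by (intro cutoff_inequality) auto
        show "0 \<le> 2 * ((\<eta> r)\<^sup>2 * (curv f r t * q r t))"
          using K_nonneg[OF r, of t] q_nonneg by simp
      qed
      finally show ?thesis .
    qed
  next
    show "(\<eta> R)\<^sup>2 * q R t + 25 * R\<^sup>2 * (U R t)\<^sup>2 \<le> 25 * R\<^sup>2 * S\<^sup>2" for t
      using sq[OF bd(1), of t] \<open>R > 0\<close> by (simp add: \<eta>_def)
    show "(\<eta> (4 * R))\<^sup>2 * q (4 * R) t + 25 * R\<^sup>2 * (U (4 * R) t)\<^sup>2 \<le> 25 * R\<^sup>2 * S\<^sup>2" for t
      using sq[OF bd(2), of t] \<open>R > 0\<close> by (simp add: \<eta>_def)
  qed (use \<open>R > 0\<close> in auto)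
  moreover have "25 * R\<^sup>2 * (U (2 * R) t)\<^sup>2 \<ge> 0" by simp
  \<comment> \<open>Here \<open>\<eta> (2 * R) = 2 * R\<^sup>2\<close>, so a factor
    \<open>R\<^sup>2\<close> cancels against the right side.\<close>
  moreover have "(\<eta> (2 * R))\<^sup>2 * q (2 * R) t = R\<^sup>2 * (4 * R\<^sup>2 * q (2 * R) t)"
    by (simp add: \<eta>_def power2_eq_square)
  moreover have "25 * R\<^sup>2 * S\<^sup>2 = R\<^sup>2 * (25 * S\<^sup>2)" by simp
  ultimately have "R\<^sup>2 * (4 * R\<^sup>2 * q (2 * R) t) \<le> R\<^sup>2 * (25 * S\<^sup>2)"
    by linarith
  then show ?thesis using \<open>R > 0\<close> by (simp add: mult_le_cancel_left_pos)
qed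

text \<open>The Laplacian of \<open>ln (1 + q)\<close> is
  \<open>4 * H / (1 + q)^2 + 2 * K * q / (1 + q)\<close>, with \<open>H\<close> the Hessian term,
  and that of \<open>ln r\<close> is \<open>k / r - 1 / r^2\<close>, at most \<open>0\<close>. The
  \<open>1 +\<close> keeps the logarithm finite where the gradient vanishes.\<close>

lemma gradient_three_circles:
  assumes "0 < c" "0 < a" "a \<le> r" "r \<le> b"
    and bd: "\<And>t. ln (1 + q a t) - c * ln a \<le> m" "\<And>t. ln (1 + q b t) - c * ln b \<le> m"
  shows "ln (1 + q r t) - c * ln r \<le> m"
proof -
  have pos: "1 + q r t > 0" for r t using q_nonneg[of r t] by simp
  show ?thesis
  proof (rule subharmonic_le_boundary[where a = a and b = b
        and \<psi> = "\<lambda>r t. ln (1 + q r t) - c * ln r"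
        and \<psi>r = "\<lambda>r t. qr r t / (1 + q r t) - c / r"
        and \<psi>rr = "\<lambda>r t. qrr r t / (1 + q r t) - (qr r t)\<^sup>2 / (1 + q r t)\<^sup>2 + c / r\<^sup>2"
        and \<psi>t = "\<lambda>r t. qt r t / (1 + q r t)"
        and \<psi>tt = "\<lambda>r t. qtt r t / (1 + q r t) - (qt r t)\<^sup>2 / (1 + q r t)\<^sup>2"])
    show "continuous_on ({a..b} \<times> UNIV) (\<lambda>(r, t). ln (1 + q r t) - c * ln r)"
      unfolding case_prod_unfold using \<open>a > 0\<close> pos
      by (intro continuous_intros q_continuous) (auto simp: less_imp_neq[symmetric])
    show "ln (1 + q r (t + 2 * pi)) - c * ln r = ln (1 + q r t) - c * ln r" if "a \<le> r" for r t
      using that \<open>a > 0\<close> by (simp add: q_periodic)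
    fix r t assume "a < r" "r < b"
    then have r: "r > 0" using \<open>a > 0\<close> by simp
    show "((\<lambda>s. ln (1 + q s t) - c * ln s) has_real_derivative
        qr r t / (1 + q r t) - c / r) (at r)"
      by (rule derivative_eq_intros q_r r pos refl | simp add: r)+
    show "((\<lambda>s. qr s t / (1 + q s t) - c / s) has_real_derivative
        qrr r t / (1 + q r t) - (qr r t)\<^sup>2 / (1 + q r t)\<^sup>2 + c / r\<^sup>2) (at r)"
    proof -
      have "((\<lambda>s. c / s) has_real_derivative - (c / r\<^sup>2)) (at r)"
        using r by (auto intro!: derivative_eq_intros simp: power2_eq_square)
      from DERIV_diff[OF has_derivative_log_derivative[OF q_r[OF r] qr_r[OF r] pos] this]
      show ?thesis by simp
    qed
    show "((\<lambda>s. ln (1 + q r s) - c * ln r) has_real_derivative qt r t / (1 + q r t)) (at t)"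
      by (rule derivative_eq_intros q_t r pos refl | simp)+
    show "((\<lambda>s. qt r s / (1 + q r s)) has_real_derivative
        qtt r t / (1 + q r t) - (qt r t)\<^sup>2 / (1 + q r t)\<^sup>2) (at t)"
      by (rule has_derivative_log_derivative[OF q_t qt_t pos]) (rule r)+
    show "0 \<le> dr f r t / f r t" using dr_f_quotient r by blast
    show "qrr r t / (1 + q r t) - (qr r t)\<^sup>2 / (1 + q r t)\<^sup>2 + c / r\<^sup>2
        + dr f r t / f r t * (qr r t / (1 + q r t) - c / r)
        + 1 / (f r t)\<^sup>2 * (qtt r t / (1 + q r t) - (qt r t)\<^sup>2 / (1 + q r t)\<^sup>2)
        + - (dt f r t / f r t ^ 3) * (qt r t / (1 + q r t)) \<ge> 0" (is "?L \<ge> 0")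
    proof -
      define k \<alpha> \<beta> where "k = dr f r t / f r t" and "\<alpha> = 1 / (f r t)\<^sup>2"
        and "\<beta> = dt f r t / f r t ^ 3"
      define H where "H = (Xr r t)\<^sup>2 + (Yr r t)\<^sup>2"
      define p where "p = inverse (1 + q r t)"
      have boch: "qrr r t + k * qr r t + \<alpha> * qtt r t - \<beta> * qt r t = 4 * H + 2 * curv f r t * q r t"
        using bochner[OF r, of t] by (simp add: k_def \<alpha>_def \<beta>_def H_def)
      have grad: "(qr r t)\<^sup>2 + \<alpha> * (qt r t)\<^sup>2 = 4 * q r t * H"
        using grad_q[OF r, of t] by (simp add: \<alpha>_def H_def)
      have p: "p * (1 + q r t) = 1" using pos[of r t] by (simp add: p_def)
      have "?L = p * (qrr r t + k * qr r t + \<alpha> * qtt r t - \<beta> * qt r t)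
          - p\<^sup>2 * ((qr r t)\<^sup>2 + \<alpha> * (qt r t)\<^sup>2) + c * (1 / r\<^sup>2 - k / r)"
        unfolding k_def[symmetric] \<alpha>_def[symmetric] \<beta>_def[symmetric]
        by (simp add: p_def divide_inverse power_inverse algebra_simps)
      \<comment> \<open>The Hessian terms combine because
        \<open>p - p\<^sup>2 * q = p\<^sup>2\<close>.\<close>
      also have "\<dots> = 4 * p\<^sup>2 * H + 2 * p * (curv f r t * q r t) + c * (1 / r\<^sup>2 - k / r)"
        unfolding boch grad using p by algebra
      also have "\<dots> \<ge> 0"
      proof -
        have "k / r \<le> 1 / r / r"
          using dr_f_quotient(2)[OF r, of t] r unfolding k_def by (intro divide_right_mono) auto
        then have "1 / r\<^sup>2 - k / r \<ge> 0" by (simp add: power2_eq_square)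
        moreover have "p \<ge> 0" "H \<ge> 0" using pos[of r t] by (auto simp: p_def H_def)
        ultimately show ?thesis
          using \<open>c > 0\<close> K_nonneg[OF r, of t] q_nonneg[of r t] by auto
      qed
      finally show ?thesis .
    qed
  qed (use assms in auto)
qed

section \<open>Bounded gradient and linear growth\<close>

lemma circle_bounded:
  assumes "r > 0"
  obtains B where "\<And>t. \<bar>U r t\<bar> \<le> B"
  using periodic_bounded[of "U r"] smooth_polar_has_dt[OF U_smooth assms] U_periodic[OF assms]
  by (metis DERIV_continuous_on UNIV_I)

text \<open>For each \<open>c > 0\<close> the three circles inequality is used on
  \<open>1 \<le> r \<le> P / 2\<close>, where growth with exponent \<open>1 + c / 4\<close> makes
  \<open>ln (1 + q)\<close> on the outer circle at most \<open>c / 2 * ln P\<close> plus a constant,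
  which \<open>c * ln (P / 2)\<close> outweighs. The resulting bound \<open>ln (1 + Q)\<close> does
  not depend on \<open>c\<close>, so \<open>c\<close> may tend to \<open>0\<close>.\<close>

lemma gradient_bounded:
  assumes growth: "\<And>\<delta> N. \<delta> > 0 \<Longrightarrow> \<exists>P\<ge>N. \<forall>t. \<bar>U P t\<bar> \<le> P powr (1 + \<delta>)"
  obtains Q where "\<And>r t. r \<ge> 1 \<Longrightarrow> q r t \<le> Q"
proof -
  obtain S where S: "\<And>t. \<bar>U 1 t\<bar> \<le> S" using circle_bounded[of 1] by auto
  have "continuous_on UNIV (q 1)"
    using q_t[of 1] by (intro DERIV_continuous_on[where D = "qt 1"]) auto
  then obtain Q where "\<And>t. \<bar>q 1 t\<bar> \<le> Q"
    using periodic_bounded[of "q 1"] q_periodic[of 1] by auto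
  then have Q: "q 1 t \<le> Q" for t by (auto simp: abs_le_iff)
  have "Q \<ge> 0" using Q[of 0] q_nonneg[of 1 0] by linarith
  have log_bound: "ln (1 + q r t) - c * ln r \<le> ln (1 + Q)" if "r \<ge> 1" "c > 0" for r t c
  proof -
    \<comment> \<open>\<open>S\<close> extends the growth bound to the unit circle, \<open>4\<close>
      ensures \<open>P / 4 \<ge> 1\<close>, the exponential absorbs \<open>ln 101\<close> and
      \<open>c * ln 2\<close>, and \<open>2 * r\<close> places \<open>r\<close> in the
      annulus.\<close>
    obtain P where P: "P \<ge> Max {S, 4, exp (2 * ln 101 / c + 2 * ln 2), 2 * r}"
      and UP: "\<And>t. \<bar>U P t\<bar> \<le> P powr (1 + c / 4)"
      using growth[of "c / 4"] \<open>c > 0\<close> by (meson divide_pos_pos zero_less_numeral)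
    then have P: "P \<ge> S" "P \<ge> 4" "P \<ge> exp (2 * ln 101 / c + 2 * ln 2)" "P \<ge> 2 * r"
      by auto
    have "P powr 1 \<le> P powr (1 + c / 4)"
      using P \<open>c > 0\<close> by (intro powr_mono) auto
    then have "S \<le> P powr (1 + c / 4)" using P by simp
    then have U1: "\<bar>U 1 t\<bar> \<le> P powr (1 + c / 4)" for t using S[of t] by linarith
    \<comment> \<open>The gradient estimate with \<open>R = P / 4\<close> also needs
      \<open>U\<close> on the circle of radius \<open>P / 4\<close>, where it is controlled from the
      circles \<open>1\<close> and \<open>P\<close>. The constant is
      \<open>100 = 25 * 16 / 4\<close>.\<close>
    have grad: "q (P / 2) t \<le> 100 * P powr (c / 2)" for t
    proof -
      have "4 * (P / 4)\<^sup>2 * q (2 * (P / 4)) t \<le> 25 * (P powr (1 + c / 4))\<^sup>2"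
      proof (rule gradient_estimate)
        show "\<bar>U (P / 4) t\<bar> \<le> P powr (1 + c / 4)" for t
          by (rule abs_U_le_boundary[of 1 _ P]) (use U1 UP P in auto)
      qed (use UP P in auto)
      moreover have "(P powr (1 + c / 4))\<^sup>2 = P\<^sup>2 * P powr (c / 2)"
        using P by (simp add: power2_eq_square powr_add[symmetric] powr_add)
      ultimately have "P\<^sup>2 * q (P / 2) t \<le> P\<^sup>2 * (100 * P powr (c / 2))"
        by (simp add: power2_eq_square)
      then show ?thesis using P by (simp add: mult_le_cancel_left_pos)
    qed
    have outer: "ln (1 + q (P / 2) t) - c * ln (P / 2) \<le> ln (1 + Q)" for t
    proof -
      have "1 \<le> P powr (c / 2)" using P \<open>c > 0\<close> by (intro ge_one_powr_ge_zero) auto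
      then have "1 + q (P / 2) t \<le> 101 * P powr (c / 2)" using grad[of t] by linarith
      then have "ln (1 + q (P / 2) t) \<le> ln (101 * P powr (c / 2))"
        using q_nonneg[of "P / 2" t] P by (subst ln_le_cancel_iff) auto
      also have "\<dots> = ln 101 + c / 2 * ln P"
        using P by (simp add: ln_mult ln_powr)
      finally have *: "ln (1 + q (P / 2) t) \<le> ln 101 + c / 2 * ln P" .
      have "2 * ln 101 / c + 2 * ln 2 \<le> ln P"
        using P by (simp add: ln_ge_iff)
      then have "c / 2 * (2 * ln 101 / c + 2 * ln 2) \<le> c / 2 * ln P"
        using \<open>c > 0\<close> by (intro mult_left_mono) auto
      then have "ln 101 + c * ln 2 \<le> c / 2 * ln P"
        using \<open>c > 0\<close> by (simp add: distrib_left)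
      moreover have "c * ln (P / 2) = c / 2 * ln P + c / 2 * ln P - c * ln 2"
        using P by (simp add: ln_div algebra_simps)
      moreover have "ln (1 + Q) \<ge> 0" using \<open>Q \<ge> 0\<close> by simp
      ultimately show ?thesis using * by linarith
    qed
    show ?thesis
    proof (rule gradient_three_circles[of c 1 r "P / 2"])
      show "ln (1 + q 1 t) - c * ln 1 \<le> ln (1 + Q)" for t
        using Q[of t] q_nonneg[of 1 t] by simp
    qed (use that outer P in auto)
  qed
  have "q r t \<le> Q" if "r \<ge> 1" for r t
  proof -
    have "ln (1 + q r t) \<le> ln (1 + Q)"
    proof (rule field_le_epsilon)
      fix e :: real assume "e > 0"
      have "ln r \<ge> 0" using that by simp
      \<comment> \<open>This is the choice \<open>c = e / (ln r + 1)\<close>; the \<open>+ 1\<close>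
        avoids a zero denominator at \<open>r = 1\<close>.\<close>
      then have "e / (ln r + 1) * ln r \<le> e" using \<open>e > 0\<close> by (simp add: field_simps)
      then show "ln (1 + q r t) \<le> ln (1 + Q) + e"
        using log_bound[OF that, of "e / (ln r + 1)" t] \<open>e > 0\<close> \<open>ln r \<ge> 0\<close> by auto
    qed
    then show ?thesis using q_nonneg[of r t] \<open>Q \<ge> 0\<close> by simp
  qed
  then show ?thesis by (rule that)
qed

text \<open>The radial derivative \<open>X\<close> is bounded by \<open>sqrt q\<close>, hence by
  \<open>sqrt Q\<close>; the mean value theorem along each ray from the unit circle does the
  rest.\<close>

lemma linear_growth:
  assumes growth: "\<And>\<delta> N. \<delta> > 0 \<Longrightarrow> \<exists>P\<ge>N. \<forall>t. \<bar>U P t\<bar> \<le> P powr (1 + \<delta>)"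
  obtains C where "C \<ge> 0" "\<And>r t. r \<ge> 1 \<Longrightarrow> \<bar>U r t\<bar> \<le> C * r"
proof -
  obtain Q where Q: "\<And>r t. r \<ge> 1 \<Longrightarrow> q r t \<le> Q" using gradient_bounded[OF growth] by blast
  obtain S where S: "\<And>t. \<bar>U 1 t\<bar> \<le> S" using circle_bounded[of 1] by auto
  have "S \<ge> 0" using S[of 0] by linarith
  have "Q \<ge> 0" using Q[of 1 0] q_nonneg[of 1 0] by linarith
  have sqrtQ: "0 \<le> sqrt Q" using \<open>Q \<ge> 0\<close> by simp
  have "\<bar>U r t\<bar> \<le> (S + sqrt Q) * r" if "r \<ge> 1" for r t
  proof (cases "r = 1")
    case True
    show ?thesis using S[of t] sqrtQ unfolding True mult_1_right by linarith
  next
    case False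
    then have "1 < r" using that by simp
    then obtain z where z: "1 < z" "z < r" "U r t - U 1 t = (r - 1) * dr U z t"
      using MVT2[of 1 r "\<lambda>r. U r t" "\<lambda>r. dr U r t"] smooth_polar_has_dr[OF U_smooth] by force
    have "(dr U z t)\<^sup>2 \<le> q z t" by (simp add: q_def X_def)
    also have "\<dots> \<le> Q" using Q z by simp
    finally have "\<bar>dr U z t\<bar> \<le> sqrt Q" by (simp add: real_le_rsqrt)
    then have "\<bar>U r t - U 1 t\<bar> \<le> (r - 1) * sqrt Q"
      unfolding z(3) abs_mult using \<open>1 < r\<close> by (intro mult_mono) auto
    moreover have "S * 1 \<le> S * r" using \<open>S \<ge> 0\<close> that by (intro mult_left_mono) auto
    moreover have "(r - 1) * sqrt Q = sqrt Q * r - sqrt Q" by (simp add: algebra_simps)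
    ultimately show ?thesis
      using S[of t] sqrtQ unfolding distrib_right by linarith
  qed
  then show ?thesis using \<open>S \<ge> 0\<close> \<open>Q \<ge> 0\<close> by (intro that[of "S + sqrt Q"]) auto
qed

end

section \<open>Return from polar coordinates to the plane\<close>

theorem theorem4:
  fixes f :: "real \<Rightarrow> real \<Rightarrow> real" and u :: "real \<times> real \<Rightarrow> real"
  assumes f_pos: "\<And>r t. r > 0 \<Longrightarrow> f r t > 0"
    and f_smooth: "smooth_polar f"
    and f_periodic: "\<And>r t. r > 0 \<Longrightarrow> f r (t + 2 * pi) = f r t"
    and f_lim0: "\<And>t. ((\<lambda>r. f r t) \<longlongrightarrow> 0) (at_right 0)"
    and f'_lim0: "\<And>t. ((\<lambda>r. dr f r t) \<longlongrightarrow> 1) (at_right 0)"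
    and K_nonneg: "\<And>r t. r > 0 \<Longrightarrow> curv f r t \<ge> 0"
    and u_cont: "continuous_on UNIV u"
    and u_smooth: "smooth_polar (polar u)"
    and u_harm: "\<And>r t. r > 0 \<Longrightarrow> lap_g f (polar u) r t = 0"
    and growth: "\<And>\<delta>::real. \<delta> > 0 \<Longrightarrow>
        Liminf at_top (\<lambda>r. ereal (Mmax (polar u) r / r powr (1 + \<delta>))) = 0"
  shows "\<exists>C>0. \<forall>p. \<bar>u p\<bar> \<le> C * (1 + norm p)"
proof -
  interpret polar_harmonic f "polar u"
    by unfold_locales (use assms in \<open>auto simp: polar_def\<close>)
  \<comment> \<open>If the quotient were at least \<open>1\<close> at all large radii, its lower
    limit would be too; so it drops below \<open>1\<close> at arbitrarily large radii.\<close>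
  have gr: "\<exists>P\<ge>N. \<forall>t. \<bar>polar u P t\<bar> \<le> P powr (1 + \<delta>)" if "\<delta> > 0" for \<delta> N :: real
  proof -
    let ?g = "\<lambda>r. Mmax (polar u) r / r powr (1 + \<delta>)"
    have "\<not> (\<forall>r\<ge>max N 1. 1 \<le> ?g r)"
    proof
      assume "\<forall>r\<ge>max N 1. 1 \<le> ?g r"
      then have "eventually (\<lambda>r. 1 \<le> ereal (?g r)) at_top"
        unfolding eventually_at_top_linorder by (intro exI[of _ "max N 1"]) simp
      from Liminf_bounded[OF this] growth[OF that] show False by simp
    qed
    then obtain P where P: "P \<ge> max N 1" "?g P < 1" by (auto simp: not_le)
    then have M: "Mmax (polar u) P \<le> P powr (1 + \<delta>)"
      by (simp add: divide_less_eq split: if_splits)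
    have "\<bar>polar u P t\<bar> \<le> Mmax (polar u) P" for t
    proof -
      \<comment> \<open>\<open>Mmax\<close> sees one period only, and its supremum bounds the values
        because they are bounded on the circle.\<close>
      obtain s where s: "0 \<le> s" "s < 2 * pi" "polar u P s = polar u P t"
        by (rule periodic_reduce[of "polar u P" t]) (use U_periodic[of P] P in auto)
      obtain B where "\<And>t. \<bar>polar u P t\<bar> \<le> B" using circle_bounded[of P] P by auto
      then have "bdd_above ((\<lambda>t. \<bar>polar u P t\<bar>) ` {0..<2*pi})"
        by (intro bdd_aboveI2[of _ _ B])
      then have "\<bar>polar u P s\<bar> \<le> Mmax (polar u) P"
        unfolding Mmax_def using s by (intro cSUP_upper) auto
      then show ?thesis using s by simp
    qed
    then show ?thesis using M P(1) order_trans by (intro exI[of _ P]) fastforce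
  qed
  obtain C where C: "C \<ge> 0" "\<And>r t. r \<ge> 1 \<Longrightarrow> \<bar>polar u r t\<bar> \<le> C * r"
    by (rule linear_growth[OF gr]) blast+
  \<comment> \<open>The polar bound covers radii at least \<open>1\<close>; on the unit disc
    continuity and compactness suffice.\<close>
  have "bounded (u ` cball 0 1)"
    by (intro compact_imp_bounded compact_continuous_image continuous_on_subset[OF u_cont]) auto
  then obtain B where B: "B > 0" "\<And>p. norm p \<le> 1 \<Longrightarrow> \<bar>u p\<bar> \<le> B"
    unfolding bounded_pos by auto
  have "\<bar>u p\<bar> \<le> (B + C) * (1 + norm p)" for p
  proof (cases "norm p \<le> 1")
    case True
    then have "\<bar>u p\<bar> \<le> B * 1" using B by simp
    also have "\<dots> \<le> (B + C) * (1 + norm p)" using B C by (intro mult_mono) auto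
    finally show ?thesis .
  next
    case False
    \<comment> \<open>The argument of this complex number is a polar angle of
      \<open>p\<close>.\<close>
    define z where "z = Complex (fst p) (snd p)"
    have z: "cmod z = norm p" by (simp add: z_def cmod_def norm_prod_def)
    have "fst p = cmod z * cos (Arg z)" "snd p = cmod z * sin (Arg z)"
      using arg_cong[OF rcis_cmod_Arg[of z], of Re] arg_cong[OF rcis_cmod_Arg[of z], of Im]
      by (simp_all add: z_def)
    then have "u p = polar u (norm p) (Arg z)"
      unfolding polar_def z[symmetric] by (metis prod.collapse)
    then have "\<bar>u p\<bar> \<le> C * norm p" using C(2)[of "norm p"] False by simp
    also have "\<dots> \<le> (B + C) * (1 + norm p)" using B C by (intro mult_mono) auto
    finally show ?thesis .
  qed
  then show ?thesis using B C by (intro exI[of _ "B + C"]) auto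
qed

end
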